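(* There is an (asymmetric) competition game with two firms on a common set of workers $N$, with value functions $v_1=I_{H_1}$ and $v_2=I_{H_2}$ given by the influence in two different $2$-sparse networks $H_1,H_2$, that has no PSPE.
   Context: Competition game: $N$ is a finite set of workers, $K$ a finite set of $k\ge 2$ firms, and each firm $i\in K$ has a nondecreasing value function $v_i:2^N\to\mathbb R_+$ with $v_i(\emptyset)=0$. In step 1 all firms simultaneously choose payment policies $\mathbf x_i=(x_{ij})_{j\in N}\in\mathbb R^N$ (payments may be negative). In step 2 each worker chooses a firm or stays idle. An outcome is a pair $(P,\mathbf X)$ where $\mathbf X=(x_{ij})$ and $P=(S_0,(S_i)_{i\in K})$ is a partition of $N$ ($S_0$ = idle workers; parts may be empty). Put $x_{0j}=0$. A worker $j\in S_i$ receives $\hat x_j=x_{ij}$; firm $i$ has profit $r_i(P,\mathbf X)=v_i(S_i)-\sum_{j\in S_i}x_{ij}$. PSPE: let $\mathcal P(\mathbf X)$ be the set of partitions such that every worker $j\in S_i$ ($i\in K\cup\{0\}$) satisfies $x_{ij}=\max_{i'\in K\cup\{0\}}x_{i'j}$. A tie-breaking rule is a map $\mathbf X\mapsto P(\mathbf X)\in\mathcal P(\mathbf X)$. An outcome $(P,\mathbf X)$ is a pure subgame perfect equilibrium (PSPE) if for some tie-breaking rule: (a) $P=P(\mathbf X)$; and (b) for every $i\in K$ and every policy $\mathbf x_i'$, $r_i(P',\mathbf X')\le r_i(P,\mathbf X)$, where $\mathbf X'=(\mathbf x_{-i},\mathbf x_i')$ and $P'=P(\mathbf X')$. Influence network (independent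 cascade model): a finite directed graph $H=\langle V,E_H\rangle$ with $N\subseteq V$ and a probability $p_{u,u'}\in[0,1]$ on each edge $(u,u')$. Each edge is independently kept with its probability; when the set $S\subseteq N$ is activated, the active nodes are those reachable by a directed path of kept edges from some node of $S$. The influence $I_H(S)$ is the expected number of active nodes, where only nodes of $V\setminus N$ are counted. $H$ is $t$-sparse (with respect to $N$) if every node $u\in V$ can be reached by a directed path in $H$ from at most $t$ workers of $N$. *)

theory Defs
  imports "HOL-Probability.Probability" "HOL-Library.FuncSet"
begin

section \<open>Competition games\<close>

locale competition_game =
  fixes N :: "'w set" and K :: "'f set" and v :: "'f \<Rightarrow> 'w set \<Rightarrow> real"
  assumes finite_workers: "finite N"
    and finite_firms: "finite K"
    and two_firms: "card K \<ge> 2"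
    and value_empty: "\<And>i. i \<in> K \<Longrightarrow> v i {} = 0"
    and value_nonneg: "\<And>i S. i \<in> K \<Longrightarrow> S \<subseteq> N \<Longrightarrow> v i S \<ge> 0"
    and value_mono: "\<And>i S T. i \<in> K \<Longrightarrow> S \<subseteq> T \<Longrightarrow> T \<subseteq> N \<Longrightarrow> v i S \<le> v i T"

definition asymmetric :: "'w set \<Rightarrow> 'f set \<Rightarrow> ('f \<Rightarrow> 'w set \<Rightarrow> real) \<Rightarrow> bool" where
  "asymmetric N K v \<longleftrightarrow> (\<exists>i\<in>K. \<exists>i'\<in>K. \<exists>S. S \<subseteq> N \<and> v i S \<noteq> v i' S)"

text \<open>Policies, profiles and partitions are extensional functions, so a tie-breaking rule
  cannot depend on values outside the workers and firms of the game.\<close>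

definition policies :: "'w set \<Rightarrow> ('w \<Rightarrow> real) set" where
  "policies N = N \<rightarrow>\<^sub>E UNIV"

definition profiles :: "'w set \<Rightarrow> 'f set \<Rightarrow> ('f \<Rightarrow> 'w \<Rightarrow> real) set" where
  "profiles N K = K \<rightarrow>\<^sub>E policies N"

text \<open>The index set $K \cup \{0\}$: \<^term>\<open>None\<close> stands for the index $0$ (idle workers).\<close>

definition options :: "'f set \<Rightarrow> 'f option set" where
  "options K = insert None (Some ` K)"

fun payment :: "('f \<Rightarrow> 'w \<Rightarrow> real) \<Rightarrow> 'f option \<Rightarrow> 'w \<Rightarrow> real" where
  "payment X None j = 0"
| "payment X (Some i) j = X i j"

definition partitions :: "'w set \<Rightarrow> 'f set \<Rightarrow> ('f option \<Rightarrow> 'w set) set" where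
  "partitions N K =
     {P \<in> options K \<rightarrow>\<^sub>E Pow N. (\<Union>i\<in>options K. P i) = N \<and> disjoint_family_on P (options K)}"

definition profit ::
    "('f \<Rightarrow> 'w set \<Rightarrow> real) \<Rightarrow> 'f \<Rightarrow> ('f option \<Rightarrow> 'w set) \<Rightarrow> ('f \<Rightarrow> 'w \<Rightarrow> real) \<Rightarrow> real" where
  "profit v i P X = v i (P (Some i)) - (\<Sum>j\<in>P (Some i). X i j)"

definition best_partitions ::
    "'w set \<Rightarrow> 'f set \<Rightarrow> ('f \<Rightarrow> 'w \<Rightarrow> real) \<Rightarrow> ('f option \<Rightarrow> 'w set) set" where
  "best_partitions N K X =
     {P \<in> partitions N K. \<forall>i\<in>options K. \<forall>j\<in>P i.
        payment X i j = Max ((\<lambda>i'. payment X i' j) ` options K)}"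

definition tie_breaking_rule ::
    "'w set \<Rightarrow> 'f set \<Rightarrow> (('f \<Rightarrow> 'w \<Rightarrow> real) \<Rightarrow> ('f option \<Rightarrow> 'w set)) \<Rightarrow> bool" where
  "tie_breaking_rule N K \<tau> \<longleftrightarrow> (\<forall>X\<in>profiles N K. \<tau> X \<in> best_partitions N K X)"

definition PSPE ::
    "'w set \<Rightarrow> 'f set \<Rightarrow> ('f \<Rightarrow> 'w set \<Rightarrow> real)
      \<Rightarrow> ('f option \<Rightarrow> 'w set) \<Rightarrow> ('f \<Rightarrow> 'w \<Rightarrow> real) \<Rightarrow> bool" where
  "PSPE N K v P X \<longleftrightarrow>
     P \<in> partitions N K \<and> X \<in> profiles N K \<and>
     (\<exists>\<tau>. tie_breaking_rule N K \<tau> \<and> P = \<tau> X \<and>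
        (\<forall>i\<in>K. \<forall>x'\<in>policies N.
           profit v i (\<tau> (X(i := x'))) (X(i := x')) \<le> profit v i P X))"

section \<open>Influence networks\<close>

record 'a network =
  nodes :: "'a set"
  edges :: "('a \<times> 'a) set"
  edge_prob :: "'a \<times> 'a \<Rightarrow> real"

definition influence_network :: "'a network \<Rightarrow> 'a set \<Rightarrow> bool" where
  "influence_network H N \<longleftrightarrow>
     finite (nodes H) \<and> N \<subseteq> nodes H \<and> edges H \<subseteq> nodes H \<times> nodes H \<and>
     (\<forall>e\<in>edges H. 0 \<le> edge_prob H e \<and> edge_prob H e \<le> 1)"

definition active_nodes :: "('a \<times> 'a) set \<Rightarrow> 'a set \<Rightarrow> 'a set" where
  "active_nodes A S = {u. \<exists>s\<in>S. (s, u) \<in> A\<^sup>*}"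

text \<open>An outcome \<open>\<omega>\<close> of the product distribution marks every edge independently as kept
  or not.\<close>

definition influence :: "'a network \<Rightarrow> 'a set \<Rightarrow> 'a set \<Rightarrow> real" where
  "influence H N S =
     measure_pmf.expectation (Pi_pmf (edges H) False (\<lambda>e. bernoulli_pmf (edge_prob H e)))
       (\<lambda>\<omega>. real (card (active_nodes {e \<in> edges H. \<omega> e} S \<inter> (nodes H - N))))"

definition t_sparse :: "nat \<Rightarrow> 'a network \<Rightarrow> 'a set \<Rightarrow> bool" where
  "t_sparse t H N \<longleftrightarrow> (\<forall>u\<in>nodes H. card {w \<in> N. (w, u) \<in> (edges H)\<^sup>*} \<le> t)"

end

theory Submission
  imports Defs
begin

text \<open>A firm can hire any set \<open>T\<close> by outbidding the current highest payments by an arbitrarily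
  small amount and deterring all other workers with negative payments. Hence the highest payments
  of a PSPE are Walrasian prices: every firm demands its own part, and idle workers have price \<open>0\<close>.

  Without probabilities, firm 1 covers one item by the workers \<open>{0, 1}\<close> and one by \<open>{1, 2}\<close>, while
  firm 2 covers one item by \<open>{0, 2}\<close> and one by \<open>{1}\<close>. Giving firm 1 the bundles \<open>{0, 2}\<close> and \<open>{1}\<close>,
  and firm 2 the bundles \<open>{0, 1}\<close> and \<open>{2}\<close>, each with weight \<open>1/2\<close>, is a fractional allocation of
  welfare \<open>7/2\<close>, whereas every partition has welfare at most \<open>3\<close>. This integrality gap rules
  out Walrasian prices.\<close>

section \<open>Walrasian prices from equilibrium payments\<close>

definition top_payment :: "'f set \<Rightarrow> ('f \<Rightarrow> 'w \<Rightarrow> real) \<Rightarrow> 'w \<Rightarrow> real" where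
  "top_payment K X j = Max ((\<lambda>i. payment X i j) ` options K)"

lemma options_finite: "finite K \<Longrightarrow> finite (options K)"
  by (simp add: options_def)

lemma payment_le_top_payment:
  assumes "finite K" "i \<in> options K"
  shows "payment X i j \<le> top_payment K X j"
  unfolding top_payment_def using assms by (intro Max_ge) (auto simp: options_finite)

lemma best_partitions_payment:
  assumes "P \<in> best_partitions N K X" "i \<in> options K" "j \<in> P i"
  shows "payment X i j = top_payment K X j"
  using assms by (auto simp: best_partitions_def top_payment_def)

text \<open>Firm \<open>i\<close> can deviate so that it hires exactly \<open>T\<close>, whatever
  the tie-breaking rule, at a cost that exceeds the top payments by at most \<open>e\<close>.
  Optimality bounds the profit of this deviation, and \<open>e\<close> is arbitrary.\<close>

lemma PSPE_profit_ge:
  assumes fin: "finite N" "finite K"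
    and eq: "PSPE N K v P X" and i: "i \<in> K" and T: "T \<subseteq> N"
  shows "v i T - (\<Sum>j\<in>T. top_payment K X j) \<le> profit v i P X"
proof (rule field_le_epsilon)
  fix e :: real
  assume "e > 0"
  \<comment> \<open>The \<open>+ 1\<close> keeps the denominator positive when \<open>T\<close> is
    empty.\<close>
  define d where "d = e / (real (card T) + 1)"
  have "d > 0"
    using \<open>e > 0\<close> by (simp add: d_def)
  have "real (card T) * d \<le> e"
    using \<open>e > 0\<close> by (simp add: d_def field_simps)
  from eq obtain \<tau> where tau: "tie_breaking_rule N K \<tau>" and X: "X \<in> profiles N K"
    and opt: "\<And>x'. x' \<in> policies N \<Longrightarrow>
      profit v i (\<tau> (X(i := x'))) (X(i := x')) \<le> profit v i P X"
    using i unfolding PSPE_def by blast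
  \<comment> \<open>All preferences become strict: workers in \<open>T\<close> get more than any
    other option pays, and the others get less than the 0 of staying idle.\<close>
  define x' where "x' = restrict (\<lambda>j. if j \<in> T then top_payment K X j + d else -1) N"
  let ?X = "X(i := x')"
  have x': "x' \<in> policies N"
    by (auto simp: x'_def policies_def)
  have "?X \<in> profiles N K"
    using X x' i unfolding profiles_def by (auto simp: PiE_iff extensional_def)
  then have best: "\<tau> ?X \<in> best_partitions N K ?X"
    using tau by (auto simp: tie_breaking_rule_def)
  then have part: "\<tau> ?X \<in> partitions N K"
    by (simp add: best_partitions_def)
  have iopt: "Some i \<in> options K"
    using i by (simp add: options_def)
  have "\<tau> ?X (Some i) = T"
  proof (intro equalityI subsetI)
    fix j
    assume j: "j \<in> \<tau> ?X (Some i)"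
    then have "j \<in> N"
      using part iopt by (auto simp: partitions_def PiE_iff)
    have "payment ?X None j \<le> payment ?X (Some i) j"
      using best_partitions_payment[OF best iopt j] payment_le_top_payment[OF fin(2), of None ?X j]
      by (simp add: options_def)
    then show "j \<in> T"
      using \<open>j \<in> N\<close> by (auto simp: x'_def split: if_splits)
  next
    fix j
    assume j: "j \<in> T"
    then have "j \<in> N"
      using T by blast
    then obtain k where k: "k \<in> options K" "j \<in> \<tau> ?X k"
      using part by (auto simp: partitions_def)
    have "k = Some i"
    proof (rule ccontr)
      assume "k \<noteq> Some i"
      \<comment> \<open>The deviation changes only the offers of \<open>i\<close>, so any other
        option still pays at most the old top payment, which is \<open>d\<close> below the new
        offer.\<close>
      then have "payment ?X k j = payment X k j"
        by (cases k) auto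
      moreover have "payment X k j \<le> top_payment K X j"
        using payment_le_top_payment[OF fin(2) k(1)] .
      moreover have "payment ?X (Some i) j \<le> payment ?X k j"
        using payment_le_top_payment[OF fin(2) iopt, of ?X j] best_partitions_payment[OF best k]
        by simp
      ultimately show False
        using j \<open>j \<in> N\<close> \<open>d > 0\<close> by (simp add: x'_def)
    qed
    then show "j \<in> \<tau> ?X (Some i)"
      using k by simp
  qed
  then have "profit v i (\<tau> ?X) ?X = v i T - (\<Sum>j\<in>T. x' j)"
    by (simp add: profit_def)
  also have "(\<Sum>j\<in>T. x' j) = (\<Sum>j\<in>T. top_payment K X j + d)"
    using T by (intro sum.cong) (auto simp: x'_def)
  also have "\<dots> = (\<Sum>j\<in>T. top_payment K X j) + real (card T) * d"
    by (simp add: sum.distrib)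
  finally show "v i T - (\<Sum>j\<in>T. top_payment K X j) \<le> profit v i P X + e"
    using opt[OF x'] \<open>real (card T) * d \<le> e\<close> by linarith
qed

text \<open>Each worker receives its top payment from the part it belongs to, so wages paid by the
  firms add up to all prices; idle workers contribute price 0.\<close>

lemma PSPE_sum_profit:
  assumes fin: "finite N" "finite K" and eq: "PSPE N K v P X"
  shows "(\<Sum>i\<in>K. profit v i P X) = (\<Sum>i\<in>K. v i (P (Some i))) - (\<Sum>j\<in>N. top_payment K X j)"
proof -
  have best: "P \<in> best_partitions N K X"
    using eq by (auto simp: PSPE_def tie_breaking_rule_def)
  then have part: "P \<in> options K \<rightarrow>\<^sub>E Pow N" "(\<Union>i\<in>options K. P i) = N"
      "disjoint_family_on P (options K)"
    by (auto simp: best_partitions_def partitions_def)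
  have "(\<Sum>j\<in>N. top_payment K X j) = (\<Sum>i\<in>options K. \<Sum>j\<in>P i. top_payment K X j)"
    unfolding part(2)[symmetric]
  proof (rule sum.UNION_disjoint)
    show "finite (options K)"
      using fin(2) by (rule options_finite)
    show "\<forall>i\<in>options K. finite (P i)"
      using part(1) fin(1) by (auto simp: PiE_iff intro: finite_subset)
    show "\<forall>i\<in>options K. \<forall>j\<in>options K. i \<noteq> j \<longrightarrow> P i \<inter> P j = {}"
      using part(3) by (auto simp: disjoint_family_on_def)
  qed
  also have "\<dots> = (\<Sum>i\<in>options K. \<Sum>j\<in>P i. payment X i j)"
    by (intro sum.cong refl) (simp add: best_partitions_payment[OF best])
  also have "\<dots> = (\<Sum>i\<in>K. \<Sum>j\<in>P (Some i). X i j)"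
    using fin(2) by (simp add: options_def sum.reindex)
  finally show ?thesis
    by (simp add: profit_def sum_subtractf)
qed

section \<open>Deterministic bipartite networks\<close>

lemma rtrancl_bipartite:
  assumes "E \<subseteq> A \<times> B" "A \<inter> B = {}"
  shows "E\<^sup>* = E\<^sup>="
proof -
  \<comment> \<open>No edge starts where another ends, so transitivity holds vacuously.\<close>
  have "trans E"
    using assms unfolding trans_def by blast
  then show ?thesis
    by (simp add: rtrancl_trancl_reflcl trancl_id)
qed

text \<open>Every edge is kept surely, so the product distribution is a point mass at the full edge
  set.\<close>

lemma influence_deterministic:
  assumes "finite (edges H)" "\<And>e. edge_prob H e = 1"
  shows "influence H N S = real (card (active_nodes (edges H) S \<inter> (nodes H - N)))"
proof -
  have "bernoulli_pmf 1 = return_pmf True"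
  proof (rule pmf_eqI)
    show "pmf (bernoulli_pmf 1) b = pmf (return_pmf True) b" for b
      by (cases b) simp_all
  qed
  then have "Pi_pmf (edges H) False (\<lambda>e. bernoulli_pmf (edge_prob H e))
      = return_pmf (\<lambda>e. e \<in> edges H)"
    using assms by (simp add: Pi_pmf_return_pmf)
  then show ?thesis
    by (simp add: influence_def)
qed

text \<open>Nodes 0, 1, 2 serve as workers, and 3, 4 as the items they cover.\<close>

definition deterministic_network :: "(nat \<times> nat) set \<Rightarrow> nat network" where
  "deterministic_network E = \<lparr>nodes = {0, 1, 2, 3, 4}, edges = E, edge_prob = (\<lambda>_. 1)\<rparr>"

lemma influence_deterministic_network:
  assumes "E \<subseteq> {0, 1, 2} \<times> {3, 4}" "S \<subseteq> {0, 1, 2}"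
  shows "influence (deterministic_network E) {0, 1, 2} S
    = of_bool (\<exists>s\<in>S. (s, 3) \<in> E) + of_bool (\<exists>s\<in>S. (s, 4) \<in> E)"
proof -
  have "finite E"
    using assms(1) by (rule finite_subset) simp
  have "E\<^sup>* = E\<^sup>="
    using assms(1) by (rule rtrancl_bipartite) simp
  then have "active_nodes E S \<inter> ({0, 1, 2, 3, 4} - {0, 1, 2})
      = (if \<exists>s\<in>S. (s, 3) \<in> E then {3} else {}) \<union> (if \<exists>s\<in>S. (s, 4) \<in> E then {4} else {})"
    using assms(2) by (auto simp: active_nodes_def)
  then show ?thesis
    using \<open>finite E\<close> by (simp add: influence_deterministic deterministic_network_def)
qed

lemma influence_network_deterministic_network:
  assumes "E \<subseteq> {0, 1, 2} \<times> {3, 4}"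
  shows "influence_network (deterministic_network E) {0, 1, 2}"
proof -
  have "{0, 1, 2} \<times> {3, 4} \<subseteq> {0, 1, 2, 3, 4} \<times> {0, 1, 2, 3, 4 :: nat}"
    by auto
  with assms have "E \<subseteq> {0, 1, 2, 3, 4} \<times> {0, 1, 2, 3, 4}"
    by (rule subset_trans)
  then show ?thesis
    unfolding influence_network_def deterministic_network_def by simp
qed

text \<open>A worker is reached from no worker but itself, and every other node is missed by at
  least one of the three workers.\<close>

lemma t_sparse_deterministic_network:
  assumes "E \<subseteq> {0, 1, 2} \<times> {3, 4}" "\<And>u. \<exists>w\<in>{0, 1, 2}. (w, u) \<notin> E"
  shows "t_sparse 2 (deterministic_network E) {0, 1, 2}"
  unfolding t_sparse_def
proof
  fix u
  have "E\<^sup>* = E\<^sup>="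
    using assms(1) by (rule rtrancl_bipartite) simp
  then have R: "{w \<in> {0, 1, 2}. (w, u) \<in> E\<^sup>*} = {w \<in> {0, 1, 2}. w = u \<or> (w, u) \<in> E}"
    by auto
  have "{w \<in> {0, 1, 2}. w = u \<or> (w, u) \<in> E} \<subset> {0, 1, 2}"
  proof (cases "u \<in> {0, 1, 2}")
    case True
    with assms(1) have "{w \<in> {0, 1, 2}. w = u \<or> (w, u) \<in> E} \<subseteq> {u}"
      by auto
    also have "{u} \<subset> {0, 1, 2}"
      using True by auto
    finally show ?thesis .
  next
    case False
    obtain w where w: "w \<in> {0, 1, 2}" "(w, u) \<notin> E"
      using assms(2) by (rule bexE)
    with False have "w \<noteq> u"
      by metis
    with w(2) have "w \<notin> {w \<in> {0, 1, 2}. w = u \<or> (w, u) \<in> E}"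
      by simp
    with w(1) show ?thesis
      by (intro psubsetI) (rule Collect_restrict, metis)
  qed
  then have "card {w \<in> {0, 1, 2}. w = u \<or> (w, u) \<in> E} < card {0, 1, 2 :: nat}"
    by (intro psubset_card_mono) auto
  then show "card {w \<in> {0, 1, 2}. (w, u) \<in> (edges (deterministic_network E))\<^sup>*} \<le> 2"
    using R by (simp add: deterministic_network_def)
qed

section \<open>The game without equilibrium\<close>

theorem corollary5p5:
  "\<exists>(N :: nat set) (H1 :: nat network) (H2 :: nat network) (v :: nat \<Rightarrow> nat set \<Rightarrow> real).
     influence_network H1 N \<and> influence_network H2 N \<and> H1 \<noteq> H2 \<and>
     t_sparse 2 H1 N \<and> t_sparse 2 H2 N \<and>
     v 1 = influence H1 N \<and> v 2 = influence H2 N \<and>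
     competition_game N {1, 2} v \<and> asymmetric N {1, 2} v \<and>
     \<not> (\<exists>P X. PSPE N {1, 2} v P X)"
proof -
  define N :: "nat set" where "N = {0, 1, 2}"
  define E1 E2 :: "(nat \<times> nat) set"
    where "E1 = {(0, 3), (1, 3), (1, 4), (2, 4)}" and "E2 = {(0, 3), (2, 3), (1, 4)}"
  define H1 H2 where "H1 = deterministic_network E1" and "H2 = deterministic_network E2"
  define v where "v i = influence (if i = 1 then H1 else H2) N" for i :: nat
  have E: "E1 \<subseteq> {0, 1, 2} \<times> {3, 4}" "E2 \<subseteq> {0, 1, 2} \<times> {3, 4}"
    by (auto simp: E1_def E2_def)
  have v1: "v 1 S = of_bool (0 \<in> S \<or> 1 \<in> S) + of_bool (1 \<in> S \<or> 2 \<in> S)" if "S \<subseteq> N" for S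
  proof -
    have "(\<exists>s\<in>S. (s, 3) \<in> E1) \<longleftrightarrow> 0 \<in> S \<or> 1 \<in> S" "(\<exists>s\<in>S. (s, 4) \<in> E1) \<longleftrightarrow> 1 \<in> S \<or> 2 \<in> S"
      by (auto simp: E1_def)
    then show ?thesis
      using influence_deterministic_network[OF E(1), of S] that by (simp add: v_def H1_def N_def)
  qed
  have v2: "v 2 S = of_bool (0 \<in> S \<or> 2 \<in> S) + of_bool (1 \<in> S)" if "S \<subseteq> N" for S
  proof -
    have "(\<exists>s\<in>S. (s, 3) \<in> E2) \<longleftrightarrow> 0 \<in> S \<or> 2 \<in> S" "(\<exists>s\<in>S. (s, 4) \<in> E2) \<longleftrightarrow> 1 \<in> S"
      by (auto simp: E2_def)
    then show ?thesis
      using influence_deterministic_network[OF E(2), of S] that by (simp add: v_def H2_def N_def)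
  qed
  have game: "competition_game N {1, 2} v"
  proof
    fix i :: nat and S T
    assume "i \<in> {1, 2}"
    then consider "i = 1" | "i = 2"
      by blast
    note i_cases = this
    show "v i {} = 0"
      using i_cases by cases (simp_all add: v1 v2 del: One_nat_def)
    show "v i S \<ge> 0" if "S \<subseteq> N"
      using i_cases that by cases (simp_all add: v1 v2 del: One_nat_def)
    show "v i S \<le> v i T" if ST: "S \<subseteq> T" and T: "T \<subseteq> N"
    proof -
      have S: "S \<subseteq> N"
        using ST T by (rule subset_trans)
      show ?thesis
        using i_cases
      proof cases
        case 1
        show ?thesis
          unfolding 1 v1[OF S] v1[OF T] using ST
          by (intro add_mono) (auto simp: of_bool_def)
      next
        case 2
        show ?thesis
          unfolding 2 v2[OF S] v2[OF T] using ST
          by (intro add_mono) (auto simp: of_bool_def)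
      qed
    qed
  qed (auto simp: N_def)
  have False if eq: "PSPE N {1, 2} v P X" for P X
  proof -
    define p where "p = top_payment {1, 2} X"
    have fin: "finite N" "finite {1, 2 :: nat}"
      by (auto simp: N_def)
    have ge: "v i T - sum p T \<le> profit v i P X" if "i \<in> {1, 2}" "T \<subseteq> N" for i T
      using PSPE_profit_ge[OF fin eq that] by (simp add: p_def)
    have "P \<in> partitions N {1, 2}"
      using eq by (simp add: PSPE_def)
    then have S: "P (Some 1) \<subseteq> N" "P (Some 2) \<subseteq> N" "P (Some 1) \<inter> P (Some 2) = {}"
      by (auto simp: partitions_def options_def PiE_iff disjoint_family_on_def)
    \<comment> \<open>Welfare 4 would need value 2 for both firms. Firm 2 then holds worker 1 and
      one of 0, 2, which leaves firm 1 at most one worker, of value 1.\<close>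
    have "v 1 (P (Some 1)) + v 2 (P (Some 2)) \<le> 3"
      unfolding v1[OF S(1)] v2[OF S(2)] using S(3) by (auto simp: of_bool_def)
    moreover have "profit v 1 P X + profit v 2 P X
        = v 1 (P (Some 1)) + v 2 (P (Some 2)) - (p 0 + p 1 + p 2)"
      using PSPE_sum_profit[OF fin eq] by (simp add: p_def N_def add.assoc)
    moreover have "2 - (p 0 + p 2) \<le> profit v 1 P X" "2 - p 1 \<le> profit v 1 P X"
      using ge[of 1 "{0, 2}"] ge[of 1 "{1}"] v1[of "{0, 2}"] v1[of "{1}"] by (auto simp: N_def)
    moreover have "2 - (p 0 + p 1) \<le> profit v 2 P X" "1 - p 2 \<le> profit v 2 P X"
      using ge[of 2 "{0, 1}"] ge[of 2 "{2}"] v2[of "{0, 1}"] v2[of "{2}"] by (auto simp: N_def)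
    \<comment> \<open>In the sum of the four bounds each price occurs twice: 7 minus twice the total
      price is at most twice the total profit, which is at most 6 minus twice the total
      price.\<close>
    ultimately show False
      by linarith
  qed
  moreover have "v 1 {1} \<noteq> v 2 {1}"
    using v1[of "{1}"] v2[of "{1}"] by (simp add: N_def)
  then have "asymmetric N {1, 2} v"
    unfolding asymmetric_def by (intro bexI[of _ 1] bexI[of _ 2] exI[of _ "{1}"]) (auto simp: N_def)
  moreover have "H1 \<noteq> H2"
    using \<open>v 1 {1} \<noteq> v 2 {1}\<close> by (auto simp: v_def)
  moreover have "influence_network H1 N" "influence_network H2 N"
    unfolding H1_def H2_def N_def by (intro influence_network_deterministic_network E)+
  moreover have "t_sparse 2 H1 N" "t_sparse 2 H2 N"
    unfolding H1_def H2_def N_def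
    by (rule t_sparse_deterministic_network; auto simp: E1_def E2_def)+
  moreover have "v 1 = influence H1 N" "v 2 = influence H2 N"
    by (simp_all add: v_def fun_eq_iff)
  ultimately show ?thesis
    using game
    by - (rule exI[of _ N], rule exI[of _ H1], rule exI[of _ H2], rule exI[of _ v], blast)
qed

end
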